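(* For positive integers $t,d,r$ let $N(t,d,r)$ be the smallest positive integer $N$ such that for any set of $N$ points in $\mathbb{R}^d$ there is a partition of the set into $r$ parts $A_1,\ldots,A_r$ such that for every set $C$ of at most $t$ of the points, $\bigcap_{j=1}^r \operatorname{conv}(A_j\setminus C)\neq\emptyset$. Then \[ N(t,d,r) = rt + \tilde{O}\left(r^2\sqrt{td} + r^3 d\right), \] that is, there are absolute constants $K,m>0$ such that for all positive integers $t,d,r$, \[ |N(t,d,r) - rt| \le K\left(r^2\sqrt{td}+r^3 d\right)\left(\ln(2+t+d+r)\right)^{m}. \]
   Context: $\operatorname{conv}(X)$ denotes the convex hull of $X\subset\mathbb{R}^d$. The notation $\tilde O(\cdot)$ hides an absolute constant and only polylogarithmic factors in $t$, $d$ and $r$. *)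

theory Defs
  imports "HOL-Analysis.Analysis" "HOL-Library.Function_Algebras"
begin

text \<open>
  The dimension \<open>d\<close> is quantified inside the scope of the absolute constants, so it cannot be
  a type parameter. As in \<^theory>\<open>HOL-Analysis.Abstract_Euclidean_Space\<close>, the space
  \<open>\<real>\<^sup>d\<close> is the set \<^term>\<open>topspace (Euclidean_space d)\<close> of all
  functions \<^typ>\<open>nat \<Rightarrow> real\<close> that vanish at every index \<open>i \<ge> d\<close>. The following
  pointwise vector space structure makes the library notion of convex hull available; since the
  set above is a linear subspace, hulls of its subsets stay inside it.
\<close>

instantiation "fun" :: (type, real_vector) real_vector
begin

definition scaleR_fun :: "real \<Rightarrow> ('a \<Rightarrow> 'b) \<Rightarrow> 'a \<Rightarrow> 'b"
  where "scaleR_fun c f = (\<lambda>x. c *\<^sub>R f x)"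

instance
  by standard (simp_all add: scaleR_fun_def fun_eq_iff scaleR_add_right scaleR_add_left)

end

text \<open>
  The parts in \<^const>\<open>partition_on\<close> are nonempty. This is no restriction: the case
  \<open>C = {}\<close> of the tolerance condition already forces every part to be nonempty.
\<close>

definition tolerant_partition ::
    "nat \<Rightarrow> nat \<Rightarrow> (nat \<Rightarrow> real) set \<Rightarrow> (nat \<Rightarrow> real) set set \<Rightarrow> bool"
  where "tolerant_partition t r X P \<longleftrightarrow>
    partition_on X P \<and> card P = r \<and>
    (\<forall>C. C \<subseteq> X \<and> card C \<le> t \<longrightarrow> (\<Inter>A\<in>P. convex hull (A - C)) \<noteq> {})"

definition tolerant_tverberg :: "nat \<Rightarrow> nat \<Rightarrow> nat \<Rightarrow> nat \<Rightarrow> bool"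
  where "tolerant_tverberg t d r N \<longleftrightarrow>
    (\<forall>X. X \<subseteq> topspace (Euclidean_space d) \<and> finite X \<and> card X = N \<longrightarrow>
      (\<exists>P. tolerant_partition t r X P))"

definition tverberg_number :: "nat \<Rightarrow> nat \<Rightarrow> nat \<Rightarrow> nat"
  where "tverberg_number t d r = (LEAST N. N > 0 \<and> tolerant_tverberg t d r N)"

end

theory Submission
  imports Defs
begin

text \<open>
  The lower bound \<open>r t\<close> is immediate: if some part had at most \<open>t\<close> points, removing all of
  them would leave an empty hull.

  For the upper bound, colour the \<open>N\<close> given points independently and uniformly at random with
  \<open>r\<close> colours and take the colour classes as the parts. By linear programming duality in the
  form given by Sarkaria's transformation (\<open>hulls_meet_or_functionals\<close>), the hulls of the colour
  classes of a finite set have no common point only if there are affine functions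
  \<open>f\<^sub>1, \<dots>, f\<^sub>r\<close> with sum zero such that \<open>f\<^sub>j\<close> is positive on class \<open>j\<close>. Hence, if the
  colouring does not tolerate the removal of some \<open>t\<close> points, there are such functions for which
  at most \<open>t\<close> points \<open>x\<close> satisfy \<open>f\<^sub>j x \<le> 0\<close> for their own colour \<open>j\<close>. But since the \<open>f\<^sub>j\<close> add
  up to zero, every point satisfies \<open>f\<^sub>j x \<le> 0\<close> for at least one of the \<open>r\<close> colours; so for fixed
  functions the expected number of points with \<open>f\<^sub>j x \<le> 0\<close> for their own colour is at least
  \<open>N / r\<close>, and a Chernoff bound (\<open>card_colourings_few_hits_le\<close>) shows that it is at most \<open>t\<close> only
  with probability \<open>exp (- (N - r t)\<^sup>2 / (2 r N))\<close>.

  Only the traces of the half-spaces \<open>f\<^sub>j \<le> 0\<close> on the point set matter. Half-spaces in dimension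
  \<open>d\<close> shatter no set of more than \<open>d + 1\<close> points, so by the Sauer-Shelah lemma there are at most
  \<open>(N + 1) ^ (d + 1)\<close> traces (\<open>card_halfspace_traces_le\<close>), hence at most
  \<open>(N + 1) ^ ((d + 1) r)\<close> tuples of them. A union bound over these tuples
  (\<open>exists_tolerant_colouring\<close>) produces a good colouring as soon as \<open>(N - r t)\<^sup>2\<close> exceeds
  \<open>2 r\<^sup>2 (d + 1) N ln (N + 1)\<close>, and \<open>union_bound_numerics\<close> checks that an excess \<open>N - r t\<close> of the
  claimed order suffices, with a single logarithmic factor.
\<close>

section \<open>Theorems of the alternative\<close>

text \<open>
  Bartl's induction on the number of vectors is used instead of a separation theorem because it
  is purely algebraic: it works in any real vector space, without a norm or an inner product, and
  therefore applies to spaces of functions.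
\<close>

lemma farkas:
  fixes a :: "'i \<Rightarrow> 'a::real_vector"
  assumes "finite I"
  shows "(\<exists>l. (\<forall>i\<in>I. 0 \<le> l i) \<and> b = (\<Sum>i\<in>I. l i *\<^sub>R a i)) \<or>
         (\<exists>\<phi> :: 'a \<Rightarrow> real. linear \<phi> \<and> (\<forall>i\<in>I. 0 \<le> \<phi> (a i)) \<and> \<phi> b < 0)"
  using assms
proof (induction I arbitrary: a b rule: finite_induct)
  case empty
  show ?case
  proof (cases "b = 0")
    case False
    then have "independent {b}"
      by simp
    then obtain \<phi> :: "'a \<Rightarrow> real" where "linear \<phi>" "\<forall>x\<in>{b}. \<phi> x = (\<lambda>_. - 1) x"
      using linear_independent_extend[of "{b}" "\<lambda>_. - 1 :: real"] by blast
    then show ?thesis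
      by (intro disjI2 exI[of _ \<phi>]) auto
  qed simp
next
  case (insert k I)
  consider (cone) l where "\<forall>i\<in>I. 0 \<le> l i" "b = (\<Sum>i\<in>I. l i *\<^sub>R a i)"
    | (sep) \<phi> :: "'a \<Rightarrow> real" where "linear \<phi>" "\<forall>i\<in>I. 0 \<le> \<phi> (a i)" "\<phi> b < 0"
    using insert.IH[where a = a and b = b] by blast
  then show ?case
  proof cases
    case cone
    then have "(\<Sum>i\<in>I. l i *\<^sub>R a i) = (\<Sum>i\<in>I. (l(k := 0)) i *\<^sub>R a i)"
      using insert.hyps by (intro sum.cong) auto
    with cone insert.hyps show ?thesis
      by (intro disjI1 exI[of _ "l(k := 0)"]) auto
  next
    case sep
    show ?thesis
    proof (cases "0 \<le> \<phi> (a k)")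
      case True
      with sep show ?thesis
        by (intro disjI2 exI[of _ \<phi>]) auto
    next
      case False
      then have neg: "\<phi> (a k) < 0"
        by simp
      \<comment> \<open>Only \<open>a k\<close> lies on the wrong side of \<open>\<phi>\<close>: project along \<open>a k\<close> onto the kernel of \<open>\<phi>\<close>,
        which sends this vector to zero, and apply the induction hypothesis again.\<close>
      define p where "p y = y - (\<phi> y / \<phi> (a k)) *\<^sub>R a k" for y
      interpret \<phi>: linear \<phi>
        by fact
      have p: "linear p"
        unfolding p_def
        by (rule linearI) (simp_all add: \<phi>.add \<phi>.scaleR algebra_simps add_divide_distrib)
      have pk: "p (a k) = 0"
        using neg by (simp add: p_def)
      consider (cone') l where "\<forall>i\<in>I. 0 \<le> l i" "p b = (\<Sum>i\<in>I. l i *\<^sub>R p (a i))"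
        | (sep') \<psi> :: "'a \<Rightarrow> real" where "linear \<psi>" "\<forall>i\<in>I. 0 \<le> \<psi> (p (a i))" "\<psi> (p b) < 0"
        using insert.IH[where a = "\<lambda>i. p (a i)" and b = "p b"] by blast
      then show ?thesis
      proof cases
        case cone'
        define \<mu> where "\<mu> = (\<phi> b - (\<Sum>i\<in>I. l i * \<phi> (a i))) / \<phi> (a k)"
        have "0 \<le> (\<Sum>i\<in>I. l i * \<phi> (a i))"
          using cone'(1) sep(2) by (intro sum_nonneg) simp
        then have \<mu>: "0 \<le> \<mu>"
          unfolding \<mu>_def using neg sep(3) by (intro divide_nonpos_neg) auto
        have "b = (\<Sum>i\<in>I. l i *\<^sub>R p (a i)) + (\<phi> b / \<phi> (a k)) *\<^sub>R a k"
          using cone'(2) by (simp add: p_def algebra_simps)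
        also have "(\<Sum>i\<in>I. l i *\<^sub>R p (a i)) =
            (\<Sum>i\<in>I. l i *\<^sub>R a i) - ((\<Sum>i\<in>I. l i * \<phi> (a i)) / \<phi> (a k)) *\<^sub>R a k"
          by (simp add: p_def scaleR_diff_right sum_subtractf sum_divide_distrib scaleR_left.sum)
        finally have b: "b = (\<Sum>i\<in>I. l i *\<^sub>R a i) + \<mu> *\<^sub>R a k"
          by (simp add: \<mu>_def diff_divide_distrib algebra_simps)
        have "(\<Sum>i\<in>I. l i *\<^sub>R a i) = (\<Sum>i\<in>I. (l(k := \<mu>)) i *\<^sub>R a i)"
          using insert.hyps by (intro sum.cong) auto
        with b \<mu> cone'(1) insert.hyps show ?thesis
          by (intro disjI1 exI[of _ "l(k := \<mu>)"]) (auto simp: add.commute)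
      next
        case sep'
        then have "linear (\<lambda>y. \<psi> (p y))"
          using linear_compose[OF p] by (simp add: o_def)
        with sep' pk show ?thesis
          by (intro disjI2 exI[of _ "\<lambda>y. \<psi> (p y)"]) (auto simp: linear_0)
      qed
    qed
  qed
qed

text \<open>
  The vectors \<open>a i\<close> have \<open>0\<close> in their convex hull iff the lifted vectors \<open>(a i, 1)\<close> have
  \<open>(0, 1)\<close> in their cone. A functional separating \<open>(0, 1)\<close> from the cone is negative on the
  new axis, which leaves room for strict positivity on the \<open>a i\<close>.
\<close>

lemma gordan:
  fixes a :: "'i \<Rightarrow> 'a::real_vector"
  assumes "finite I"
  shows "(\<exists>l. (\<forall>i\<in>I. 0 \<le> l i) \<and> sum l I = 1 \<and> (\<Sum>i\<in>I. l i *\<^sub>R a i) = 0) \<or>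
         (\<exists>\<phi> :: 'a \<Rightarrow> real. linear \<phi> \<and> (\<forall>i\<in>I. 0 < \<phi> (a i)))"
proof -
  consider (cone) l where "\<forall>i\<in>I. 0 \<le> l i" "(0, 1) = (\<Sum>i\<in>I. l i *\<^sub>R (a i, 1::real))"
    | (sep) \<phi> :: "'a \<times> real \<Rightarrow> real"
      where "linear \<phi>" "\<forall>i\<in>I. 0 \<le> \<phi> (a i, 1)" "\<phi> (0, 1) < 0"
    using farkas[OF assms, of "(0, 1)" "\<lambda>i. (a i, 1)"] by blast
  then show ?thesis
  proof cases
    case cone
    then have "(0, 1) = ((\<Sum>i\<in>I. l i *\<^sub>R a i), sum l I)"
      by (simp add: prod_eq_iff fst_sum snd_sum)
    with cone(1) show ?thesis
      by auto
  next
    case sep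
    have lin: "linear (\<lambda>y. \<phi> (y, 0))"
      using linear_compose[of "\<lambda>y. (y, 0)" \<phi>] sep(1)
      by (simp add: o_def linear_iff)
    have "\<phi> (a i, 1) = \<phi> (a i, 0) + \<phi> (0, 1)" for i
      using linear_add[OF sep(1), of "(a i, 0)" "(0, 1)"] by simp
    with sep(2,3) lin show ?thesis
      by (intro disjI2 exI[of _ "\<lambda>y. \<phi> (y, 0)"]) fastforce
  qed
qed

section \<open>Sarkaria's transformation\<close>

lemma sum_fun_apply: "(\<Sum>i\<in>I. g i) x = (\<Sum>i\<in>I. g i x)"
  for g :: "'i \<Rightarrow> 'b \<Rightarrow> 'a::comm_monoid_add"
  by (induction I rule: infinite_finite_induct) (simp_all)

text \<open>
  Sarkaria's trick. Choose \<open>r\<close> vectors \<open>u 0, \<dots>, u (r - 1)\<close> whose only linear relation, up to scaling,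
  is that their sum vanishes, and replace a point \<open>x\<close> of colour \<open>j\<close> by the tensor
  \<open>u j \<otimes> (x, 1)\<close>. A convex combination of these tensors that vanishes says that all colour
  classes contribute the same vector \<open>\<Sum> l x (x, 1)\<close>; after rescaling this is a point common to
  all hulls. Otherwise a functional is positive on all tensors, and its restrictions to the
  \<open>r\<close> slices \<open>u j \<otimes> _\<close> are affine functions of \<open>x\<close> that add up to zero.

  Affine functions on \<open>'a\<close> are represented throughout as linear functions on \<open>'a \<times> real\<close>
  evaluated at \<open>(x, 1)\<close>.
\<close>

lemma hulls_meet_or_functionals:
  fixes c :: "'a::real_vector \<Rightarrow> nat"
  assumes B: "finite B" and c: "c ` B \<subseteq> {..<r}"
  shows "(\<Inter>j<r. convex hull {x\<in>B. c x = j}) \<noteq> {} \<or>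
    (\<exists>f :: nat \<Rightarrow> 'a \<times> real \<Rightarrow> real. (\<forall>j. linear (f j)) \<and>
        (\<forall>y. (\<Sum>j<r. f j y) = 0) \<and> (\<forall>x\<in>B. 0 < f (c x) (x, 1)))"
proof (cases "r = 0")
  case False
  define u :: "nat \<Rightarrow> nat \<Rightarrow> real" where "u j k = of_bool (j = k) - 1 / r" for j k
  \<comment> \<open>The tensor \<open>u j \<otimes> y\<close>, encoded as the function \<open>k \<mapsto> u j k *\<^sub>R y\<close>.\<close>
  define v :: "nat \<Rightarrow> 'a \<times> real \<Rightarrow> nat \<Rightarrow> 'a \<times> real"
    where "v j y = (\<lambda>k. if k < r then u j k *\<^sub>R y else 0)" for j y
  have lin_v: "linear (v j)" for j
    by (rule linearI)
      (auto simp: v_def fun_eq_iff scaleR_fun_def algebra_simps)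
  have sum_v: "(\<Sum>j<r. v j y) = 0" for y
  proof
    fix k
    have "(\<Sum>j<r. u j k) = 0" if "k < r"
      using that False by (simp add: u_def sum_subtractf of_bool_def)
    then show "(\<Sum>j<r. v j y) k = 0 k"
      by (cases "k < r") (simp_all add: sum_fun_apply v_def flip: scaleR_left.sum)
  qed
  consider (conv) l where "\<forall>x\<in>B. 0 \<le> l x" "sum l B = 1" "(\<Sum>x\<in>B. l x *\<^sub>R v (c x) (x, 1)) = 0"
    | (sep) \<phi> :: "(nat \<Rightarrow> 'a \<times> real) \<Rightarrow> real"
      where "linear \<phi>" "\<forall>x\<in>B. 0 < \<phi> (v (c x) (x, 1))"
    using gordan[OF B, of "\<lambda>x. v (c x) (x, 1)"] by blast
  then show ?thesis
  proof cases
    case conv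
    define z where "z = (\<Sum>x\<in>B. l x *\<^sub>R x)"
    have "z \<in> convex hull {x\<in>B. c x = k}" if k: "k < r" for k
    proof -
      let ?B = "{x\<in>B. c x = k}"
      \<comment> \<open>Coordinate \<open>k\<close> of the vanishing combination compares class \<open>k\<close> with \<open>1 / r\<close> of the total.\<close>
      have "0 = (\<Sum>x\<in>B. l x *\<^sub>R v (c x) (x, 1)) k"
        by (simp add: conv(3))
      also have "\<dots> = (\<Sum>x\<in>B. (of_bool (c x = k) * l x) *\<^sub>R (x, 1) - (1 / r) *\<^sub>R (l x *\<^sub>R (x, 1)))"
        using k by (simp add: sum_fun_apply scaleR_fun_def v_def u_def algebra_simps)
      also have "\<dots> = (\<Sum>x\<in>B. (of_bool (c x = k) * l x) *\<^sub>R (x, 1)) - (1 / r) *\<^sub>R (\<Sum>x\<in>B. l x *\<^sub>R (x, 1))"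
        by (simp only: sum_subtractf scaleR_right.sum)
      also have "(\<Sum>x\<in>B. (of_bool (c x = k) * l x) *\<^sub>R (x, 1::real)) = (\<Sum>x\<in>?B. l x *\<^sub>R (x, 1))"
        using B by (simp add: sum.inter_filter zero_prod_def of_bool_def if_distrib if_distribR cong: if_cong)
      also have "(\<Sum>x\<in>B. l x *\<^sub>R (x, 1::real)) = (z, 1)"
        using conv(2) by (simp add: z_def prod_eq_iff fst_sum snd_sum)
      finally have "(z, 1::real) = real r *\<^sub>R (\<Sum>x\<in>?B. l x *\<^sub>R (x, 1))"
        using False by simp
      also have "\<dots> = (\<Sum>x\<in>?B. (r * l x) *\<^sub>R (x, 1))"
        by (simp add: scaleR_right.sum)
      finally have "z = (\<Sum>x\<in>?B. (r * l x) *\<^sub>R x)" "1 = (\<Sum>x\<in>?B. r * l x)"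
        by (simp_all add: prod_eq_iff fst_sum snd_sum)
      then show ?thesis
        using B conv(1) by (auto simp: convex_hull_finite intro!: exI[of _ "\<lambda>x. r * l x"])
    qed
    then show ?thesis
      by blast
  next
    case sep
    have "(\<Sum>j<r. \<phi> (v j y)) = 0" for y
      using linear_sum[OF sep(1), of "\<lambda>j. v j y" "{..<r}"] by (simp add: sum_v linear_0[OF sep(1)])
    moreover have "linear (\<lambda>y. \<phi> (v j y))" for j
      using linear_compose[OF lin_v sep(1)] by (simp add: o_def)
    ultimately show ?thesis
      using sep(2) by (intro disjI2 exI[of _ "\<lambda>j y. \<phi> (v j y)"]) auto
  qed
qed (simp)

section \<open>Counting the traces of half-spaces\<close>

definition shattered :: "'a set set \<Rightarrow> 'a set \<Rightarrow> bool"
  where "shattered F S \<longleftrightarrow> (\<forall>T\<subseteq>S. \<exists>A\<in>F. A \<inter> S = T)"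

text \<open>
  Pajor's form of the Sauer-Shelah lemma. Removing a point \<open>x\<close> splits \<open>F\<close> into the members
  without \<open>x\<close> (\<open>F0\<close>) and those with \<open>x\<close>, from which \<open>x\<close> is deleted (\<open>F1\<close>). A set shattered by
  either is shattered by \<open>F\<close>, and a set shattered by both stays shattered when \<open>x\<close> is added;
  inclusion-exclusion then counts exactly the two families of the induction hypothesis.
\<close>

lemma card_le_card_shattered:
  assumes "finite X" "F \<subseteq> Pow X"
  shows "card F \<le> card {S. S \<subseteq> X \<and> shattered F S}"
  using assms
proof (induction X arbitrary: F rule: finite_induct)
  case empty
  then consider "F = {}" | "F = {{}}"
    by (metis Pow_empty subset_singletonD)
  then show ?case
    by cases (auto simp: shattered_def card_gt_0_iff Suc_le_eq)
next
  case (insert x X)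
  define F0 F1 where "F0 = {A\<in>F. x \<notin> A}" and "F1 = {A. A \<subseteq> X \<and> insert x A \<in> F}"
  define Sh where "Sh G = {S. S \<subseteq> X \<and> shattered G S}" for G
  have sub: "F0 \<subseteq> Pow X" "F1 \<subseteq> Pow X"
    using insert.prems by (auto simp: F0_def F1_def)
  have F: "F = F0 \<union> insert x ` F1"
  proof (intro equalityI subsetI)
    fix A assume A: "A \<in> F"
    show "A \<in> F0 \<union> insert x ` F1"
    proof (cases "x \<in> A")
      case True
      then have "A = insert x (A - {x})" "A - {x} \<in> F1"
        using A insert.prems by (auto simp: F1_def insert_absorb)
      then show ?thesis
        by blast
    qed (use A in \<open>simp add: F0_def\<close>)
  qed (auto simp: F0_def F1_def)
  have finS: "finite (Sh G)" for G
    using insert.hyps(1) by (simp add: Sh_def)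
  have ShD: "\<exists>A\<in>G. A \<inter> S = T" if "S \<in> Sh G" "T \<subseteq> S" for G S T
    using that by (simp add: Sh_def shattered_def)
  have inj: "inj_on (insert x) (Pow X)"
    using insert.hyps(2) by (auto simp: inj_on_def)
  have "card F \<le> card F0 + card F1"
    unfolding F using sub insert.hyps(1)
    by (intro order.trans[OF card_Un_le] add_left_mono card_image_le)
       (auto dest: finite_subset)
  also have "\<dots> \<le> card (Sh F0) + card (Sh F1)"
    unfolding Sh_def using sub by (intro add_mono insert.IH)
  also have "\<dots> = card (Sh F0 \<union> Sh F1) + card (Sh F0 \<inter> Sh F1)"
    using finS finS by (rule card_Un_Int)
  also have "card (Sh F0 \<inter> Sh F1) = card (insert x ` (Sh F0 \<inter> Sh F1))"
    using inj by (intro card_image[symmetric]) (auto intro: inj_on_subset simp: Sh_def)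
  also have "card (Sh F0 \<union> Sh F1) + \<dots> = card ((Sh F0 \<union> Sh F1) \<union> insert x ` (Sh F0 \<inter> Sh F1))"
    using finS insert.hyps(2) by (intro card_Un_disjoint[symmetric]) (auto simp: Sh_def)
  also have "\<dots> \<le> card {S. S \<subseteq> insert x X \<and> shattered F S}"
  proof (intro card_mono subsetI)
    show "finite {S. S \<subseteq> insert x X \<and> shattered F S}"
      using insert.hyps(1) by simp
    fix S assume "S \<in> (Sh F0 \<union> Sh F1) \<union> insert x ` (Sh F0 \<inter> Sh F1)"
    then consider "S \<in> Sh F0" | "S \<in> Sh F1"
      | S' where "S = insert x S'" "S' \<in> Sh F0" "S' \<in> Sh F1"
      by blast
    then have "S \<subseteq> insert x X \<and> shattered F S"
    proof cases
      case 1
      moreover have "F0 \<subseteq> F"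
        by (simp add: F0_def)
      ultimately show ?thesis
        unfolding Sh_def shattered_def by blast
    next
      case 2
      then have "x \<notin> S"
        using insert.hyps(2) by (auto simp: Sh_def)
      then have "insert x A \<inter> S = A \<inter> S" for A
        by blast
      moreover have "\<exists>A\<in>F1. A \<inter> S = T" if "T \<subseteq> S" for T
        using ShD[OF 2 that] .
      ultimately have "shattered F S"
        unfolding shattered_def F1_def by (metis (lifting) mem_Collect_eq)
      with 2 show ?thesis
        by (auto simp: Sh_def)
    next
      case 3
      then have S': "S' \<subseteq> X" "x \<notin> S'"
        using insert.hyps(2) by (auto simp: Sh_def)
      have "\<exists>A\<in>F. A \<inter> S = T" if T: "T \<subseteq> S" for T
      proof (cases "x \<in> T")
        case True
        have "T - {x} \<subseteq> S'"
          using T 3(1) \<open>x \<in> T\<close> by blast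
        then obtain A where "A \<in> F1" "A \<inter> S' = T - {x}"
          using ShD[OF 3(3)] by metis
        then show ?thesis
          using True 3(1) by (intro bexI[of _ "insert x A"]) (auto simp: F1_def)
      next
        case False
        then have "T \<subseteq> S'"
          using T 3(1) \<open>x \<notin> T\<close> by blast
        then obtain A where "A \<in> F0" "A \<inter> S' = T"
          using ShD[OF 3(2)] by metis
        then show ?thesis
          using False 3(1) by (intro bexI[of _ A]) (auto simp: F0_def)
      qed
      then show ?thesis
        using 3(1) S'(1) unfolding shattered_def by blast
    qed
    then show "S \<in> {S. S \<subseteq> insert x X \<and> shattered F S}"
      by simp
  qed
  finally show ?case .
qed

text \<open>
  A subset with at most \<open>k\<close> elements is listed by a word of length exactly \<open>k\<close> over \<open>X\<close> with one
  extra padding letter.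
\<close>

lemma card_small_subsets_le:
  assumes "finite X"
  shows "card {S. S \<subseteq> X \<and> card S \<le> k} \<le> (card X + 1) ^ k"
proof -
  let ?A = "insert None (Some ` X)"
  let ?L = "{xs. set xs \<subseteq> ?A \<and> length xs = k}"
  have fin: "finite ?L"
    using assms by (intro finite_lists_length_eq) simp
  have "{S. S \<subseteq> X \<and> card S \<le> k} \<subseteq> (\<lambda>xs. {x. Some x \<in> set xs}) ` ?L"
  proof
    fix S assume "S \<in> {S. S \<subseteq> X \<and> card S \<le> k}"
    then have S: "S \<subseteq> X" "card S \<le> k"
      by auto
    then obtain ys where ys: "set ys = S" "distinct ys"
      using assms finite_distinct_list finite_subset by metis
    then have "length ys \<le> k"
      using S distinct_card by metis
    with ys S show "S \<in> (\<lambda>xs. {x. Some x \<in> set xs}) ` ?L"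
      by (intro image_eqI[of _ _ "map Some ys @ replicate (k - length ys) None"]) (auto split: if_splits)
  qed
  then have "card {S. S \<subseteq> X \<and> card S \<le> k} \<le> card ?L"
    using fin by (rule surj_card_le[rotated])
  also have "\<dots> = (card X + 1) ^ k"
    using assms by (subst card_lists_length_eq) (simp_all add: card_image)
  finally show ?thesis .
qed

definition halfspace_traces :: "'a::real_vector set \<Rightarrow> 'a set set"
  where "halfspace_traces X =
    {{x\<in>X. f (x, 1) \<le> 0} | f :: 'a \<times> real \<Rightarrow> real. linear f}"

text \<open>
  The Vapnik-Chervonenkis dimension of half-spaces. If the lifted points \<open>(x, 1)\<close> satisfy a
  linear relation with coefficients \<open>l x\<close>, no affine function can be nonpositive exactly at
  the points with \<open>l x < 0\<close>: its weighted sum over \<open>S\<close> would be positive instead of zero. So a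
  shattered set lifts to an independent one.
\<close>

lemma card_shattered_by_halfspaces_le:
  fixes X :: "'a::real_vector set"
  assumes X: "X \<subseteq> span T" and T: "finite T" and S: "S \<subseteq> X" "finite S"
    and shat: "shattered (halfspace_traces X) S"
  shows "card S \<le> card T + 1"
proof -
  let ?h = "\<lambda>x::'a. (x, 1::real)"
  have "independent (?h ` S)"
  proof
    assume "dependent (?h ` S)"
    then obtain U g w where U: "finite U" "U \<subseteq> ?h ` S" "(\<Sum>y\<in>U. g y *\<^sub>R y) = 0"
      and w: "w \<in> U" "g w \<noteq> 0"
      unfolding dependent_explicit by blast
    \<comment> \<open>The sign factor turns the relation around, if necessary, so that some coefficient is positive.\<close>
    define l where "l x = (if ?h x \<in> U then sgn (g w) * g (?h x) else 0)" for x
    obtain x0 where x0: "x0 \<in> S" "w = ?h x0"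
      using U w by auto
    have "l x0 > 0"
      using x0 w by (auto simp: l_def sgn_real_def)
    have "(\<Sum>x\<in>S. l x *\<^sub>R ?h x) = (\<Sum>x\<in>{x\<in>S. ?h x \<in> U}. (sgn (g w) * g (?h x)) *\<^sub>R ?h x)"
      using S(2) by (subst sum.inter_filter) (auto simp: l_def zero_prod_def intro!: sum.cong)
    also have "\<dots> = (\<Sum>y\<in>U. (sgn (g w) * g y) *\<^sub>R y)"
      using U(2) by (intro sum.reindex_bij_betw) (auto simp: bij_betw_def inj_on_def)
    also have "\<dots> = sgn (g w) *\<^sub>R (\<Sum>y\<in>U. g y *\<^sub>R y)"
      by (simp add: scaleR_right.sum)
    finally have l0: "(\<Sum>x\<in>S. l x *\<^sub>R ?h x) = 0"
      using U(3) by simp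
    have "{x\<in>S. l x < 0} \<subseteq> S"
      by auto
    then obtain f :: "'a \<times> real \<Rightarrow> real" where f: "linear f"
      and tr: "{x\<in>X. f (?h x) \<le> 0} \<inter> S = {x\<in>S. l x < 0}"
      using shat unfolding shattered_def halfspace_traces_def by blast
    have sgn: "f (?h x) \<le> 0 \<longleftrightarrow> l x < 0" if "x \<in> S" for x
      using tr that S(1) by blast
    have "0 = f (\<Sum>x\<in>S. l x *\<^sub>R ?h x)"
      by (simp only: l0 linear_0[OF f])
    also have "\<dots> = (\<Sum>x\<in>S. l x * f (?h x))"
      by (simp only: linear_sum[OF f] linear_cmul[OF f] real_scaleR_def)
    also have "\<dots> > 0"
    proof (rule sum_pos2[OF S(2) x0(1)])
      show "0 < l x0 * f (?h x0)"
        using \<open>l x0 > 0\<close> sgn[OF x0(1)] by (simp add: not_le)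
      show "0 \<le> l x * f (?h x)" if "x \<in> S" for x
        using sgn[OF that] by (cases "l x < 0") (auto intro: mult_nonpos_nonpos)
    qed
    finally show False
      by simp
  qed
  moreover let ?T = "insert (0, 1::real) ((\<lambda>v. (v, 0)) ` T)"
  have lin: "linear (\<lambda>v::'a. (v, 0::real))"
    by (rule linearI) auto
  have "?h ` S \<subseteq> span ?T"
  proof
    fix y assume "y \<in> ?h ` S"
    then obtain x where x: "x \<in> span T" "y = ?h x"
      using S X by blast
    have "(x, 0) \<in> span ((\<lambda>v. (v, 0::real)) ` T)"
      using x(1) linear_span_image[OF lin, of T] by blast
    then have "(x, 0) \<in> span ?T"
      by (rule subsetD[OF span_mono[OF subset_insertI]])
    moreover have "(0, 1) \<in> span ?T"
      by (rule span_base) simp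
    ultimately show "y \<in> span ?T"
      using span_add[of "(x, 0)" ?T "(0, 1)"] x(2) by simp
  qed
  ultimately have "card (?h ` S) \<le> card ?T"
    using T independent_span_bound[of ?T "?h ` S"] by blast
  also have "\<dots> \<le> Suc (card T)"
    using T by (intro order.trans[OF card_insert_le_m1[OF _ ]]) (auto intro: card_image_le)
  finally show ?thesis
    by (simp add: card_image inj_on_def)
qed

lemma card_halfspace_traces_le:
  fixes X :: "'a::real_vector set"
  assumes X: "X \<subseteq> span T" "finite X" and T: "finite T"
  shows "finite (halfspace_traces X)" "card (halfspace_traces X) \<le> (card X + 1) ^ (card T + 1)"
proof -
  have sub: "halfspace_traces X \<subseteq> Pow X"
    by (auto simp: halfspace_traces_def)
  then show "finite (halfspace_traces X)"
    using X(2) by (auto dest: finite_subset)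
  have "card (halfspace_traces X) \<le> card {S. S \<subseteq> X \<and> shattered (halfspace_traces X) S}"
    using X(2) sub by (rule card_le_card_shattered)
  also have "\<dots> \<le> card {S. S \<subseteq> X \<and> card S \<le> card T + 1}"
    using X T card_shattered_by_halfspaces_le[OF X(1) T] 
    by (intro card_mono) (auto dest: finite_subset)
  also have "\<dots> \<le> (card X + 1) ^ (card T + 1)"
    using X(2) by (rule card_small_subsets_le)
  finally show "card (halfspace_traces X) \<le> (card X + 1) ^ (card T + 1)" .
qed

section \<open>Random colourings\<close>

lemma exp_minus_le_quadratic:
  assumes "0 \<le> (s::real)"
  shows "exp (- s) \<le> 1 - s + s\<^sup>2 / 2"
proof -
  have pos: "0 < 1 - s + s\<^sup>2 / 2"
    using sum_squares_gt_zero_iff[of "s - 1" 1] by (simp add: power2_eq_square algebra_simps)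
  have "(1 - s + s\<^sup>2 / 2) * (1 + s + s\<^sup>2 / 2) = 1 + s ^ 4 / 4"
    by (simp add: power2_eq_square power4_eq_xxxx algebra_simps)
  then have "1 \<le> (1 - s + s\<^sup>2 / 2) * (1 + s + s\<^sup>2 / 2)"
    by simp
  also have "\<dots> \<le> (1 - s + s\<^sup>2 / 2) * exp s"
    using pos exp_lower_Taylor_quadratic[OF assms]
    by (intro mult_left_mono) auto
  finally show ?thesis
    by (simp add: exp_minus field_simps)
qed

text \<open>
  The multiplicative Chernoff bound, phrased as a count of colourings. The number of hits of a
  uniformly random colouring is a sum of independent indicators, each of probability at least
  \<open>1 / r\<close>, so it exceeds \<open>t\<close> except with small probability. The moment
  \<open>\<Sum>c. q ^ hits c\<close> factors over the points of \<open>X\<close>, which replaces independence.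
\<close>

lemma card_colourings_few_hits_le:
  fixes G :: "'a \<Rightarrow> nat set"
  assumes X: "finite X" "0 < card X" and r: "0 < r" and t: "r * t \<le> card X"
    and G: "\<And>x. x \<in> X \<Longrightarrow> G x \<inter> {..<r} \<noteq> {}"
  shows "real (card {c \<in> X \<rightarrow>\<^sub>E {..<r}. card {x\<in>X. c x \<in> G x} \<le> t})
    \<le> real r ^ card X * exp (- ((real (card X) - r * t)\<^sup>2 / (2 * r * card X)))"
    (is "real (card ?bad) \<le> _")
proof -
  define n where "n = card X"
  \<comment> \<open>This \<open>s\<close> minimises the exponent \<open>s * t - n / r * (s - s\<^sup>2 / 2)\<close>.\<close>
  define s where "s = (real n - r * t) / n"
  define q where "q = exp (- s)"
  have n: "0 < n" and rt: "real r * real t \<le> real n"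
    using X t by (auto simp: n_def simp flip: of_nat_mult)
  have s: "0 \<le> s"
    using rt by (simp add: s_def)
  then have q: "0 < q" "q \<le> 1"
    by (auto simp: q_def)
  have finE: "finite (X \<rightarrow>\<^sub>E {..<r})"
    using X by (intro finite_PiE) auto
  let ?w = "\<lambda>x j. if j \<in> G x then q else 1"
  have hits: "q ^ card {x\<in>X. c x \<in> G x} = (\<Prod>x\<in>X. ?w x (c x))" for c
    using X(1) by (simp flip: prod.inter_filter)
  have colour: "(\<Sum>j<r. ?w x j) \<le> r - (1 - q)" if x: "x \<in> X" for x
  proof -
    obtain j where j: "j < r" "j \<in> G x"
      using G[OF x] by auto
    have "(\<Sum>i<r. ?w x i) = q + (\<Sum>i\<in>{..<r} - {j}. ?w x i)"
      using j by (subst sum.remove[of _ j]) auto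
    also have "(\<Sum>i\<in>{..<r} - {j}. ?w x i) \<le> (\<Sum>i\<in>{..<r} - {j}. 1)"
      using q by (intro sum_mono) auto
    finally show ?thesis
      using j r by (simp add: of_nat_diff)
  qed
  have "q ^ t * card ?bad = (\<Sum>c\<in>?bad. q ^ t)"
    by simp
  also have "\<dots> \<le> (\<Sum>c\<in>?bad. q ^ card {x\<in>X. c x \<in> G x})"
    using q by (intro sum_mono power_decreasing) auto
  also have "\<dots> \<le> (\<Sum>c\<in>X \<rightarrow>\<^sub>E {..<r}. q ^ card {x\<in>X. c x \<in> G x})"
    using q finE by (intro sum_mono2) auto
  also have "\<dots> = (\<Prod>x\<in>X. \<Sum>j<r. ?w x j)"
    unfolding hits using X(1) by (intro prod_sum_PiE[symmetric]) auto
  also have "\<dots> \<le> (\<Prod>x\<in>X. r - (1 - q))"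
    using q colour by (intro prod_mono) (auto intro!: sum_nonneg)
  also have "\<dots> = (r - (1 - q)) ^ n"
    by (simp add: n_def)
  also have "\<dots> \<le> (r * exp (- ((1 - q) / r))) ^ n"
  proof (rule power_mono)
    have "r - (1 - q) = r * (1 + - ((1 - q) / r))"
      using r by (simp add: field_simps)
    also have "\<dots> \<le> r * exp (- ((1 - q) / r))"
      by (intro mult_left_mono exp_ge_add_one_self) simp
    finally show "r - (1 - q) \<le> r * exp (- ((1 - q) / r))" .
    show "0 \<le> r - (1 - q)"
      using r q by linarith
  qed
  also have "\<dots> = r ^ n * exp (- (n / r * (1 - q)))"
    by (simp add: power_mult_distrib flip: exp_of_nat_mult)
  also have "\<dots> \<le> r ^ n * exp (- (n / r * (s - s\<^sup>2 / 2)))"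
    using exp_minus_le_quadratic[OF s] r
    by (intro mult_left_mono) (auto simp: q_def intro!: mult_left_mono divide_right_mono)
  finally have "card ?bad \<le> r ^ n * exp (- (n / r * (s - s\<^sup>2 / 2))) / q ^ t"
    using q by (simp add: field_simps)
  also have "\<dots> = r ^ n * exp (s * t - n / r * (s - s\<^sup>2 / 2))"
    by (simp add: q_def exp_diff exp_minus field_simps flip: exp_of_nat_mult exp_add)
  also have "s * t - n / r * (s - s\<^sup>2 / 2) = - ((real n - r * t)\<^sup>2 / (2 * r * n))"
    using n r by (simp add: s_def field_simps power2_eq_square)
  finally show ?thesis
    by (simp add: n_def)
qed

text \<open>
  The union bound. If after the removal of \<open>C\<close> the hulls of the colour classes have no common point, the dual
  affine functions \<open>f j\<close> have the property that every point of \<open>X\<close> lies in one of the half-spaces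
  \<open>f j \<le> 0\<close>, because the \<open>f j\<close> add up to zero, whereas only points of \<open>C\<close> lie in the half-space
  of their own colour. So a colouring fails only if it has at most \<open>t\<close> hits with respect to one of
  the tuples of half-space traces that cover \<open>X\<close>. These tuples form the set \<open>W\<close>; there are
  polynomially many of them, and each is responsible for an exponentially small fraction of
  the colourings.
\<close>

lemma exists_tolerant_colouring:
  fixes X :: "'a::real_vector set"
  assumes X: "finite X" "0 < card X" "X \<subseteq> span T" and T: "finite T"
    and r: "0 < r" and t: "r * t \<le> card X"
    and small: "real (card X + 1) ^ ((card T + 1) * r) *
      exp (- ((real (card X) - r * t)\<^sup>2 / (2 * r * card X))) < 1"
  obtains c where "c \<in> X \<rightarrow>\<^sub>E {..<r}"
    "\<And>C. C \<subseteq> X \<Longrightarrow> card C \<le> t \<Longrightarrow> (\<Inter>j<r. convex hull {x\<in>X - C. c x = j}) \<noteq> {}"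
proof -
  let ?H = "halfspace_traces X"
  let ?p = "exp (- ((real (card X) - r * t)\<^sup>2 / (2 * r * card X)))"
  define W where "W = {h \<in> {..<r} \<rightarrow>\<^sub>E ?H. X \<subseteq> (\<Union>j<r. h j)}"
  define bad where "bad h = {c \<in> X \<rightarrow>\<^sub>E {..<r}. card {x\<in>X. c x \<in> {j. x \<in> h j}} \<le> t}"
    for h :: "nat \<Rightarrow> 'a set"
  note H = card_halfspace_traces_le[OF X(3,1) T]
  have finE: "finite ({..<r} \<rightarrow>\<^sub>E ?H)"
    using H(1) by (intro finite_PiE) auto
  then have finW: "finite W"
    by (simp add: W_def)
  have "card W \<le> card ({..<r} \<rightarrow>\<^sub>E ?H)"
    using finE by (intro card_mono) (auto simp: W_def)
  also have "\<dots> = card ?H ^ r"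
    by (simp add: card_PiE)
  also have "\<dots> \<le> ((card X + 1) ^ (card T + 1)) ^ r"
    using H(2) by (intro power_mono) auto
  also have "\<dots> = (card X + 1) ^ ((card T + 1) * r)"
    by (simp only: power_mult)
  finally have W: "real (card W) \<le> real (card X + 1) ^ ((card T + 1) * r)"
    by (metis of_nat_le_iff of_nat_power)
  have "real (card (\<Union>h\<in>W. bad h)) \<le> (\<Sum>h\<in>W. real (card (bad h)))"
    using card_UN_le[OF finW, of bad] by (metis of_nat_le_iff of_nat_sum)
  also have "\<dots> \<le> (\<Sum>h\<in>W. real r ^ card X * ?p)"
    unfolding bad_def using X(1,2) r t
    by (intro sum_mono card_colourings_few_hits_le) (auto simp: W_def)
  also have "\<dots> = real (card W) * ?p * real r ^ card X"
    by simp
  also have "\<dots> \<le> (real (card X + 1) ^ ((card T + 1) * r) * ?p) * real r ^ card X"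
    using W by (intro mult_right_mono) auto
  also have "\<dots> < 1 * real r ^ card X"
    using small r by (intro mult_strict_right_mono) auto
  also have "\<dots> = real (card (X \<rightarrow>\<^sub>E {..<r}))"
    using X(1) by (simp add: card_PiE)
  finally have "card (\<Union>h\<in>W. bad h) < card (X \<rightarrow>\<^sub>E {..<r})"
    by simp
  moreover have "finite (\<Union>h\<in>W. bad h)"
    using finW X(1) by (auto simp: bad_def intro!: finite_PiE)
  ultimately obtain c where c: "c \<in> X \<rightarrow>\<^sub>E {..<r}" and good: "\<And>h. h \<in> W \<Longrightarrow> c \<notin> bad h"
    by (metis (no_types, lifting) UN_I card_mono not_le subsetI)
  have "(\<Inter>j<r. convex hull {x\<in>X - C. c x = j}) \<noteq> {}" if C: "C \<subseteq> X" "card C \<le> t" for C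
  proof (rule ccontr)
    assume empty: "\<not> ?thesis"
    have colours: "c ` (X - C) \<subseteq> {..<r}"
      using c by auto
    obtain f :: "nat \<Rightarrow> 'a \<times> real \<Rightarrow> real"
      where f: "\<And>j. linear (f j)" "\<And>y. (\<Sum>j<r. f j y) = 0"
        and pos: "\<And>x. x \<in> X - C \<Longrightarrow> 0 < f (c x) (x, 1)"
      using mp[OF iffD1[OF disj_imp hulls_meet_or_functionals[OF finite_Diff[OF X(1)] colours]] empty]
      by blast
    define h where "h = (\<lambda>j\<in>{..<r}. {x\<in>X. f j (x, 1) \<le> 0})"
    have "\<exists>j<r. f j (x, 1) \<le> 0" for x
    proof (rule ccontr)
      assume "\<not> ?thesis"
      then have "0 < (\<Sum>j<r. f j (x, 1))"
        using r by (intro sum_pos) (auto simp: not_le)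
      then show False
        by (simp add: f(2))
    qed
    then have "X \<subseteq> (\<Union>j<r. h j)"
      by (fastforce simp: h_def)
    then have "h \<in> W"
      using f(1) by (auto simp: W_def h_def halfspace_traces_def)
    have "{x\<in>X. c x \<in> {j. x \<in> h j}} \<subseteq> C"
      using pos c by (fastforce simp: h_def split: if_splits)
    then have "card {x\<in>X. c x \<in> {j. x \<in> h j}} \<le> t"
      using C X(1) by (meson card_mono finite_subset le_trans)
    with c have "c \<in> bad h"
      by (simp add: bad_def)
    with good[OF \<open>h \<in> W\<close>] show False
      by blast
  qed
  with c show thesis
    using that by blast
qed

section \<open>Bounds for tolerant Tverberg partitions\<close>

lemma Euclidean_space_subset_span:
  "\<exists>T. finite T \<and> card T \<le> d \<and> topspace (Euclidean_space d) \<subseteq> span T"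
proof (intro exI conjI subsetI)
  define e :: "nat \<Rightarrow> nat \<Rightarrow> real" where "e i = (\<lambda>k. of_bool (k = i))" for i
  show "finite (e ` {..<d})" "card (e ` {..<d}) \<le> d"
    using card_image_le[of "{..<d}" e] by auto
  fix x assume "x \<in> topspace (Euclidean_space d)"
  then have "x = (\<Sum>i<d. x i *\<^sub>R e i)"
    by (intro ext) (auto simp: topspace_Euclidean_space sum_fun_apply scaleR_fun_def e_def
      of_bool_def if_distrib[of "(*) _"] cong: if_cong)
  also have "\<dots> \<in> span (e ` {..<d})"
    by (intro span_sum span_scale span_base) auto
  finally show "x \<in> span (e ` {..<d})" .
qed

lemma tolerant_tverberg_if:
  assumes r: "0 < r" and t: "r * t \<le> N" and N: "0 < N"
    and small: "real (N + 1) ^ ((d + 1) * r) * exp (- ((real N - r * t)\<^sup>2 / (2 * r * N))) < 1"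
  shows "tolerant_tverberg t d r N"
  unfolding tolerant_tverberg_def
proof (intro allI impI, elim conjE)
  fix X assume X: "X \<subseteq> topspace (Euclidean_space d)" "finite X" "card X = N"
  obtain T where T: "finite T" "card T \<le> d" "X \<subseteq> span T"
    using Euclidean_space_subset_span[of d] X(1) by blast
  have "real (card X + 1) ^ ((card T + 1) * r) \<le> real (N + 1) ^ ((d + 1) * r)"
    unfolding X(3) using T(2) by (intro power_increasing mult_le_mono1) auto
  then have small': "real (card X + 1) ^ ((card T + 1) * r) *
      exp (- ((real (card X) - r * t)\<^sup>2 / (2 * r * card X))) < 1"
    unfolding X(3) by (rule le_less_trans[OF mult_right_mono small]) simp
  have "0 < card X" "r * t \<le> card X"
    using X(3) N t by auto
  then obtain c where c: "c \<in> X \<rightarrow>\<^sub>E {..<r}"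
    and hull: "\<And>C. C \<subseteq> X \<Longrightarrow> card C \<le> t \<Longrightarrow> (\<Inter>j<r. convex hull {x\<in>X - C. c x = j}) \<noteq> {}"
    using exists_tolerant_colouring[OF X(2) _ T(3,1) r _ small'] by blast
  define A where "A j = {x\<in>X. c x = j}" for j
  have A: "A j \<noteq> {}" if "j < r" for j
  proof
    assume "A j = {}"
    then have "convex hull {x\<in>X - {}. c x = j} = {}"
      by (simp add: A_def)
    moreover have "(\<Inter>i<r. convex hull {x\<in>X - {}. c x = i}) \<noteq> {}"
      by (rule hull) simp_all
    ultimately show False
      using that by blast
  qed
  have "inj_on A {..<r}"
    using A by (auto simp: inj_on_def A_def)
  then have "card (A ` {..<r}) = r"
    by (simp add: card_image)
  moreover have "partition_on X (A ` {..<r})"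
    using c A by (intro partition_onI) (auto simp: A_def disjnt_def)
  moreover have "(\<Inter>B\<in>A ` {..<r}. convex hull (B - C)) \<noteq> {}" if "C \<subseteq> X" "card C \<le> t" for C
  proof -
    have "A j - C = {x\<in>X - C. c x = j}" for j
      by (auto simp: A_def)
    then show ?thesis
      using hull[OF that] by simp
  qed
  ultimately show "\<exists>P. tolerant_partition t r X P"
    unfolding tolerant_partition_def by blast
qed

text \<open>
  A part with at most \<open>t\<close> points could be removed completely, so every part has at least
  \<open>t + 1\<close> points. The assumption on \<open>d\<close> provides a set of \<open>N\<close> distinct points, here on the
  first coordinate axis.
\<close>

lemma tolerant_tverberg_lower_bound:
  assumes "tolerant_tverberg t d r N" "0 < d"
  shows "r * (t + 1) \<le> N"
proof -
  define p :: "nat \<Rightarrow> nat \<Rightarrow> real" where "p n = (\<lambda>k. if k = 0 then real n else 0)" for n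
  have "inj p"
    by (auto simp: inj_on_def p_def fun_eq_iff split: if_splits)
  define X where "X = p ` {..<N}"
  have X: "finite X" "card X = N"
    using \<open>inj p\<close> by (simp_all add: X_def card_image inj_on_subset)
  moreover have "X \<subseteq> topspace (Euclidean_space d)"
    using assms(2) by (auto simp: X_def p_def topspace_Euclidean_space)
  ultimately obtain P where "tolerant_partition t r X P"
    using assms(1) unfolding tolerant_tverberg_def by blast
  then have P: "partition_on X P" "card P = r"
    and hull: "\<And>C. C \<subseteq> X \<Longrightarrow> card C \<le> t \<Longrightarrow> (\<Inter>A\<in>P. convex hull (A - C)) \<noteq> {}"
    by (simp_all add: tolerant_partition_def)
  have sub: "A \<subseteq> X" if "A \<in> P" for A
    using P(1) that by (auto simp: partition_on_def)
  have big: "t + 1 \<le> card A" if A: "A \<in> P" for A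
  proof (rule ccontr)
    assume "\<not> ?thesis"
    then have "(\<Inter>B\<in>P. convex hull (B - A)) \<noteq> {}"
      using hull[OF sub[OF A]] by simp
    then have "convex hull (A - A) \<noteq> {}"
      using A by blast
    then show False
      by simp
  qed
  have "r * (t + 1) = (\<Sum>A\<in>P. t + 1)"
    using P(2) by simp
  also have "\<dots> \<le> (\<Sum>A\<in>P. card A)"
    using big by (rule sum_mono)
  also have "\<dots> = card (\<Union> P)"
    using P(1) sub X(1) by (intro card_Union_disjoint[symmetric])
      (auto simp: partition_on_def intro: finite_subset)
  also have "\<dots> = N"
    using P(1) X(2) by (simp add: partition_on_def)
  finally show ?thesis .
qed

text \<open>
  The union bound succeeds once \<open>M = N - r t\<close> satisfies
  \<open>(d + 1) r ln (N + 1) < M\<^sup>2 / (2 r N)\<close>, that is, up to constants and with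
  \<open>ln (N + 1) = O(L)\<close>, once \<open>M\<^sup>2\<close> exceeds both \<open>d r\<^sup>3 t L\<close> and \<open>d r\<^sup>2 L M\<close>. The first
  is guaranteed by the term \<open>r\<^sup>2 sqrt (t d)\<close> of \<open>A\<close>, the second by the term \<open>r\<^sup>3 d\<close>. The factor
  \<open>100\<close> is generous.
\<close>

lemma union_bound_numerics:
  fixes t d r :: nat
  defines "A \<equiv> real r ^ 2 * sqrt (real t * real d) + real r ^ 3 * real d"
  defines "L \<equiv> ln (2 + real t + real d + real r)"
  defines "M \<equiv> nat \<lceil>100 * A * L\<rceil>"
  defines "N \<equiv> r * t + M"
  assumes pos: "0 < t" "0 < d" "0 < r"
  shows "real M \<le> 101 * A * L"
    and "real (N + 1) ^ ((d + 1) * r) * exp (- ((real N - r * t)\<^sup>2 / (2 * r * N))) < 1"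
proof -
  define Z where "Z = 2 + real t + real d + real r"
  have tdr: "1 \<le> real t" "1 \<le> real d" "1 \<le> real r"
    using pos by auto
  have Z: "5 \<le> Z" "real t \<le> Z" "real d \<le> Z" "real r \<le> Z"
    using tdr by (auto simp: Z_def)
  have L: "1 \<le> L" "L \<le> Z"
    using Z(1) exp_le ln_ge_iff[of Z 1] ln_le_minus_one[of Z] by (auto simp: L_def simp flip: Z_def)
  have A3: "real r ^ 3 * d \<le> A" and A2: "real r ^ 2 * sqrt (real t * d) \<le> A"
    by (auto simp: A_def)
  have "1 \<le> real r ^ 3 * d"
    using tdr mult_mono[of 1 "real r ^ 3" 1 "real d"] by simp
  then have A1: "1 \<le> A"
    using A3 by linarith
  then have AL: "1 \<le> A * L"
    using L(1) mult_mono[of 1 A 1 L] by simp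
  have M: "100 * (A * L) \<le> M" "M \<le> 100 * (A * L) + 1"
    using AL unfolding M_def by linarith+
  then show "real M \<le> 101 * A * L"
    using AL by linarith
  \<comment> \<open>All quantities are polynomial in \<open>Z\<close>, so that \<open>ln (N + 1)\<close> is at most a multiple of \<open>ln Z = L\<close>.\<close>
  have "A \<le> 2 * Z ^ 4"
  proof -
    have "1 \<le> real t * d"
      using tdr mult_mono[of 1 "real t" 1 "real d"] by simp
    then have "sqrt (real t * d) \<le> real t * d"
      by (intro real_le_lsqrt) (auto simp: power2_eq_square mult_le_cancel_left1)
    also have "\<dots> \<le> Z * Z"
      using Z by (intro mult_mono) auto
    finally have "real r ^ 2 * sqrt (real t * d) \<le> Z ^ 2 * (Z * Z)"
      using Z by (intro mult_mono power_mono) auto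
    moreover have "real r ^ 3 * d \<le> Z ^ 3 * Z"
      using Z by (intro mult_mono power_mono) auto
    ultimately show ?thesis
      by (simp add: A_def eval_nat_numeral algebra_simps)
  qed
  then have "A * L \<le> (2 * Z ^ 4) * Z"
    using L A1 by (intro mult_mono) auto
  then have "M \<le> 200 * Z ^ 5 + 1"
    using M(2) by (simp add: eval_nat_numeral)
  moreover have "real r * t \<le> Z * Z"
    using Z by (intro mult_mono) auto
  moreover have "Z * Z \<le> Z ^ 5" "5 ^ 5 \<le> Z ^ 5"
    using Z power_increasing[of 2 5 Z] power_mono[of 5 Z 5] by (auto simp: power2_eq_square)
  ultimately have "real (N + 1) \<le> 3125 * Z ^ 5"
    by (simp add: N_def)
  also have "\<dots> \<le> Z ^ 5 * Z ^ 5"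
    using \<open>5 ^ 5 \<le> Z ^ 5\<close> Z by (intro mult_right_mono) auto
  also have "\<dots> = Z ^ 10"
    by (simp flip: power_add)
  finally have "ln (real (N + 1)) \<le> ln (Z ^ 10)"
    by (intro ln_mono) auto
  then have lnN: "ln (real (N + 1)) \<le> 10 * L"
    using Z by (simp add: ln_realpow L_def Z_def)
  have N: "real N = real r * t + M" "0 < real N"
    using pos by (auto simp: N_def intro!: add_pos_nonneg)
  have M0: "0 < real M"
    using M(1) AL by linarith

  \<comment> \<open>After clearing denominators the left-hand side is split according to \<open>N = r t + M\<close>.\<close>
  have "40 * (real d * real r ^ 2 * L) * M \<le> 2 / 5 * (real M * M)"
  proof -
    have "real r ^ 2 * d \<le> real r ^ 3 * d"
      using tdr by (intro mult_right_mono power_increasing) auto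
    then have "real r ^ 2 * d * L \<le> A * L"
      using A3 L(1) by (intro mult_right_mono) auto
    then have "real d * real r ^ 2 * L \<le> M / 100"
      using M(1) by (simp add: mult.commute)
    then have "40 * (real d * real r ^ 2 * L) * M \<le> 40 * (M / 100) * M"
      by (intro mult_right_mono mult_left_mono) auto
    then show ?thesis
      by simp
  qed
  moreover have "40 * (real d * real r ^ 2 * L) * (real r * t) \<le> 1 / 250 * (real M * M)"
  proof -
    have "real r ^ 3 * (real t * d) * L \<le> real r ^ 4 * (real t * d) * (L * L)"
      using tdr L(1) mult_mono[of 1 L L L] by (intro mult_mono power_increasing) auto
    also have "\<dots> = (real r ^ 2 * sqrt (real t * d) * L)\<^sup>2"
      by (simp add: power_mult_distrib power2_eq_square[of L] flip: power_mult)
    also have "\<dots> \<le> (A * L)\<^sup>2"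
      using A2 L(1) by (intro power_mono mult_right_mono) auto
    also have "\<dots> \<le> (M / 100)\<^sup>2"
      using M(1) AL by (intro power_mono) auto
    finally show ?thesis
      by (simp add: eval_nat_numeral algebra_simps)
  qed
  moreover have "0 < real M * M"
    using M0 by simp
  ultimately have key: "40 * (real d * real r ^ 2 * L) * N < (real M)\<^sup>2"
    unfolding N(1) power2_eq_square[of "real M"] distrib_left by linarith
  have "(real d + 1) * r * ln (real (N + 1)) \<le> (2 * d) * r * (10 * L)"
    using lnN tdr by (intro mult_mono) auto
  also have "\<dots> < (real M)\<^sup>2 / (2 * r * N)"
    using key N(2) tdr by (simp add: pos_less_divide_eq power2_eq_square algebra_simps)
  finally have *: "(real d + 1) * r * ln (real (N + 1)) - (real M)\<^sup>2 / (2 * r * N) < 0"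
    by simp
  have "real (N + 1) ^ ((d + 1) * r) = exp ((real d + 1) * r * ln (real (N + 1)))"
    using exp_of_nat_mult[of "(d + 1) * r" "ln (real (N + 1))"] by (simp add: distrib_right add.commute)
  then have "real (N + 1) ^ ((d + 1) * r) * exp (- ((real N - r * t)\<^sup>2 / (2 * r * N))) =
      exp ((real d + 1) * r * ln (real (N + 1)) - (real M)\<^sup>2 / (2 * r * N))"
    using N by (simp add: exp_diff exp_minus field_simps)
  also have "\<dots> < 1"
    using * by simp
  finally show "real (N + 1) ^ ((d + 1) * r) * exp (- ((real N - r * t)\<^sup>2 / (2 * r * N))) < 1" .
qed

theorem theorem1p4:
  shows "(\<forall>t d r. t > 0 \<and> d > 0 \<and> r > 0 \<longrightarrow> (\<exists>N>0. tolerant_tverberg t d r N)) \<and>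
    (\<exists>K m :: real. K > 0 \<and> m > 0 \<and>
      (\<forall>t d r :: nat. t > 0 \<and> d > 0 \<and> r > 0 \<longrightarrow>
        \<bar>real (tverberg_number t d r) - real r * real t\<bar>
          \<le> K * (real r ^ 2 * sqrt (real t * real d) + real r ^ 3 * real d)
              * ln (2 + real t + real d + real r) powr m))"
proof -
  define E where "E t d r = (real r ^ 2 * sqrt (real t * real d) + real r ^ 3 * real d)
      * ln (2 + real t + real d + real r)" for t d r :: nat
  have upper: "\<exists>N>0. tolerant_tverberg t d r N \<and> real N \<le> real r * t + 101 * E t d r"
    if "0 < t" "0 < d" "0 < r" for t d r
  proof (intro exI conjI)
    let ?M = "nat \<lceil>100 * (real r ^ 2 * sqrt (real t * real d) + real r ^ 3 * real d)
      * ln (2 + real t + real d + real r)\<rceil>"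
    show N: "0 < r * t + ?M"
      using that by simp
    show "tolerant_tverberg t d r (r * t + ?M)"
      using that N union_bound_numerics(2)[OF that] by (intro tolerant_tverberg_if) auto
    show "real (r * t + ?M) \<le> real r * t + 101 * E t d r"
      using union_bound_numerics(1)[OF that]
      by (simp only: E_def mult.assoc of_nat_add of_nat_mult add_le_cancel_left)
  qed
  have bound: "\<bar>real (tverberg_number t d r) - real r * real t\<bar> \<le> 101 * E t d r"
    if pos: "0 < t" "0 < d" "0 < r" for t d r
  proof -
    obtain N where N: "0 < N" "tolerant_tverberg t d r N" "real N \<le> real r * t + 101 * E t d r"
      using upper[OF pos] by blast
    then have "tverberg_number t d r \<le> N"
      unfolding tverberg_number_def by (intro Least_le) simp
    moreover have "tolerant_tverberg t d r (tverberg_number t d r)"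
      unfolding tverberg_number_def
      using LeastI[of "\<lambda>N. 0 < N \<and> tolerant_tverberg t d r N" N] N by blast
    then have "r * (t + 1) \<le> tverberg_number t d r"
      using pos(2) by (rule tolerant_tverberg_lower_bound)
    then have "real r * t \<le> tverberg_number t d r"
      by (metis add_leD1 distrib_left of_nat_le_iff of_nat_mult)
    ultimately show ?thesis
      using N(3) by linarith
  qed
  show ?thesis
  proof (rule conjI, use upper in blast, rule exI[of _ 101], rule exI[of _ 1], intro conjI allI impI)
    fix t d r :: nat
    assume "t > 0 \<and> d > 0 \<and> r > 0"
    then show "\<bar>real (tverberg_number t d r) - real r * real t\<bar>
        \<le> 101 * (real r ^ 2 * sqrt (real t * real d) + real r ^ 3 * real d)
              * ln (2 + real t + real d + real r) powr 1"
      using bound[of t d r] by (simp add: E_def algebra_simps)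
  qed simp_all
qed

end
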